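(* Let $R\subsetneq T$ be commutative rings with unity, where $R$ is a proper subring of $T$ containing the unity of $T$, and let $I=(R:T)$. Suppose that $U(R/I)=(R/I)\cap U(T/I)$, where $R/I$ is regarded as a subring of $T/I$ (in particular, this holds when $T$ is integral over $R$). If $R[[x]]$ is an associated subring of $T[[x]]$, then $R$ is an associated subring of $T$ and $I$ is a radical ideal of $T$.
   Context: $U(A)$ denotes the group of units of a commutative ring $A$ with identity. The conductor is $(R:T)=\{r\in R : rT\subseteq R\}$; it is an ideal of both $R$ and $T$. A subring $R$ of a commutative ring $T$ with identity is an associated subring of $T$ if for every $t\in T$ there exists $u\in U(T)$ such that $tu\in R$ (equivalently $T=R\cdot U(T)$). *)

theory Defs
  imports "HOL-Algebra.Polynomials"
begin

definition associated_subring :: "'a set \<Rightarrow> ('a, 'b) ring_scheme \<Rightarrow> bool" where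
  "associated_subring R T \<longleftrightarrow>
     subring R T \<and> (\<forall>t\<in>carrier T. \<exists>u\<in>Units T. t \<otimes>\<^bsub>T\<^esub> u \<in> R)"

definition conductor :: "'a set \<Rightarrow> ('a, 'b) ring_scheme \<Rightarrow> 'a set" where
  "conductor R T = {r \<in> R. \<forall>t\<in>carrier T. r \<otimes>\<^bsub>T\<^esub> t \<in> R}"

text \<open>The ring \<open>A[[x]]\<close>: the function \<open>f\<close> stands for the series with coefficient \<open>f n\<close> at \<open>x\<^sup>n\<close>.\<close>

definition power_series_ring :: "('a, 'b) ring_scheme \<Rightarrow> (nat \<Rightarrow> 'a) ring" where
  "power_series_ring A =
     \<lparr>carrier = UNIV \<rightarrow> carrier A,
      mult = (\<lambda>f g n. \<Oplus>\<^bsub>A\<^esub>i\<in>{..n}. f i \<otimes>\<^bsub>A\<^esub> g (n - i)),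
      one = (\<lambda>n. if n = 0 then \<one>\<^bsub>A\<^esub> else \<zero>\<^bsub>A\<^esub>),
      zero = (\<lambda>n. \<zero>\<^bsub>A\<^esub>),
      add = (\<lambda>f g n. f n \<oplus>\<^bsub>A\<^esub> g n)\<rparr>"

definition radical :: "'a set \<Rightarrow> ('a, 'b) ring_scheme \<Rightarrow> 'a set" where
  "radical I A = {a \<in> carrier A. \<exists>n::nat. n > 0 \<and> a [^]\<^bsub>A\<^esub> n \<in> I}"

definition radical_ideal :: "'a set \<Rightarrow> ('a, 'b) ring_scheme \<Rightarrow> bool" where
  "radical_ideal I A \<longleftrightarrow> ideal I A \<and> radical I A = I"

text \<open>Polynomials are lists of coefficients, leading coefficient first; the one below is monic
  over \<open>R\<close>.\<close>

definition integral_over :: "('a, 'b) ring_scheme \<Rightarrow> 'a set \<Rightarrow> bool" where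
  "integral_over T R \<longleftrightarrow>
     (\<forall>t\<in>carrier T. \<exists>p. p \<noteq> [] \<and> set p \<subseteq> R \<and> lead_coeff p = \<one>\<^bsub>T\<^esub> \<and> ring.eval T p t = \<zero>\<^bsub>T\<^esub>)"

text \<open>\<open>U(R/I) = (R/I) \<inter> U(T/I)\<close> for \<open>I \<subseteq> R\<close> an ideal of both rings. The cosets of \<open>I\<close> formed
  in \<open>T\<lparr>carrier := R\<rparr>\<close> are the sets \<open>r + I\<close> with \<open>r \<in> R\<close>, so \<open>R/I\<close> literally is a subset
  of \<open>T/I\<close>.\<close>

definition quotient_units_inherited :: "'a set \<Rightarrow> ('a, 'b) ring_scheme \<Rightarrow> 'a set \<Rightarrow> bool" where
  "quotient_units_inherited R T I \<longleftrightarrow>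
     Units (T\<lparr>carrier := R\<rparr> Quot I) = carrier (T\<lparr>carrier := R\<rparr> Quot I) \<inter> Units (T Quot I)"

end

theory Submission
  imports Defs
begin

text \<open>Everything is reduced to congruences modulo the conductor \<open>I\<close>, an ideal of \<open>T\<close> that lies
  in \<open>R\<close>: the hypothesis on units says that an element of \<open>R\<close> with an inverse modulo \<open>I\<close> in \<open>T\<close>
  has such an inverse already in \<open>R\<close> (\<open>quotient_units_inherited_iff\<close>).

  If \<open>T\<close> is integral over \<open>R\<close> and \<open>r \<otimes> t \<equiv> 1\<close> modulo \<open>I\<close> with \<open>r \<in> R\<close>, then multiplying a monic
  equation of degree \<open>n\<close> for \<open>t\<close> by \<open>r\<^sup>n\<^sup>-\<^sup>1\<close> turns its leading term into \<open>t\<close> and each other term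
  into an element of \<open>R\<close>, all modulo \<open>I\<close>. Hence \<open>t\<close> itself lies in \<open>R\<close>
  (\<open>integral_inverse_in_subring\<close>).

  If \<open>R[[x]]\<close> is associated in \<open>T[[x]]\<close>, take \<open>t \<in> T\<close> and a unit \<open>u\<close> of \<open>T[[x]]\<close> such that
  \<open>(t + x) u\<close> has coefficients in \<open>R\<close>. The first two of them are \<open>t u\<^sub>0\<close> and \<open>t u\<^sub>1 + u\<^sub>0\<close>,
  and \<open>u\<^sub>0\<close> is a unit of \<open>T\<close>. The first one shows that \<open>R\<close> is associated in \<open>T\<close>. If \<open>t\<^sup>2 \<in> I\<close>,
  then modulo \<open>I\<close> the second is a unit plus a nilpotent, hence a unit of \<open>T/I\<close>, hence a unit of
  \<open>R/I\<close> with some inverse \<open>v \<in> R\<close>. Multiplying \<open>v (t u\<^sub>1 + u\<^sub>0) \<equiv> 1\<close> by \<open>t\<close> gives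
  \<open>t \<equiv> (t u\<^sub>0) v\<close>, so \<open>t \<in> R\<close>. Applied to all multiples of \<open>t\<close>, this puts \<open>t\<close> into the
  conductor (\<open>square_in_conductor\<close>). An ideal that contains every element whose square it
  contains is radical.\<close>

section \<open>The conductor and the units of the quotients\<close>

lemma (in cring) conductor_ideal:
  assumes K: "subring K R"
  shows "ideal (conductor K R) R"
proof (rule idealI)
  note KE = subringE[OF K]
  have carr: "r \<in> carrier R" if "r \<in> conductor K R" for r
    using that KE(1) by (auto simp: conductor_def)
  show "ring R" by (rule ring_axioms)
  show "subgroup (conductor K R) (add_monoid R)"
  proof (rule add.subgroupI)
    show "conductor K R \<subseteq> carrier R" using carr by blast
    have "\<zero> \<in> conductor K R" using KE(2) by (auto simp: conductor_def)
    then show "conductor K R \<noteq> {}" by blast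
    show "\<ominus> a \<in> conductor K R" if "a \<in> conductor K R" for a
      using that carr[OF that] KE(5) by (auto simp: conductor_def l_minus)
    show "a \<oplus> b \<in> conductor K R" if "a \<in> conductor K R" "b \<in> conductor K R" for a b
      using that carr[OF that(1)] carr[OF that(2)] KE(7) by (auto simp: conductor_def l_distr)
  qed
  show right: "a \<otimes> x \<in> conductor K R" if "a \<in> conductor K R" "x \<in> carrier R" for a x
    using that carr[OF that(1)] by (auto simp: conductor_def m_assoc)
  show "x \<otimes> a \<in> conductor K R" if "a \<in> conductor K R" "x \<in> carrier R" for a x
    using right[OF that] that carr[OF that(1)] by (simp add: m_comm)
qed

lemma (in ring) ideal_in_subring:
  assumes K: "subring K R" and I: "ideal I R" and "I \<subseteq> K"
  shows "ideal I (R\<lparr>carrier := K\<rparr>)"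
proof (rule idealI)
  interpret I: ideal I R by (rule I)
  interpret S: ring "R\<lparr>carrier := K\<rparr>" by (rule subring_is_ring[OF K])
  have KR: "K \<subseteq> carrier R" by (rule subringE(1)[OF K])
  show "ring (R\<lparr>carrier := K\<rparr>)" by (rule S.ring_axioms)
  have "subgroup I ((add_monoid R)\<lparr>carrier := K\<rparr>)"
    using group.subgroup_incl[OF a_group I.a_subgroup] K \<open>I \<subseteq> K\<close>
    by (auto simp: subring_def)
  then show "subgroup I (add_monoid (R\<lparr>carrier := K\<rparr>))" by simp
  show "x \<otimes>\<^bsub>R\<lparr>carrier := K\<rparr>\<^esub> a \<in> I" "a \<otimes>\<^bsub>R\<lparr>carrier := K\<rparr>\<^esub> x \<in> I"
    if "a \<in> I" "x \<in> carrier (R\<lparr>carrier := K\<rparr>)" for a x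
    using that KR by (auto intro: I.I_l_closed I.I_r_closed)
qed

lemma carrier_FactRing: "carrier (R Quot I) = (\<lambda>a. I +>\<^bsub>R\<^esub> a) ` carrier R"
  by (auto simp: FactRing_def A_RCOSETS_def')

lemma (in cring) coset_in_Units_iff:
  assumes I: "ideal I R" and s: "s \<in> carrier R"
  shows "I +> s \<in> Units (R Quot I) \<longleftrightarrow> (\<exists>v\<in>carrier R. I +> (s \<otimes> v) = I +> \<one>)"
proof -
  interpret I: ideal I R by (rule I)
  have mult: "(I +> a) \<otimes>\<^bsub>R Quot I\<^esub> (I +> b) = I +> (a \<otimes> b)"
    if "a \<in> carrier R" "b \<in> carrier R" for a b
    using I.rcoset_mult_add[OF that] by (simp add: FactRing_def)
  have one: "\<one>\<^bsub>R Quot I\<^esub> = I +> \<one>" by (simp add: FactRing_def)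
  show ?thesis
    using s by (auto simp: Units_def carrier_FactRing mult one m_comm)
qed

text \<open>The coset of an element does not depend on whether it is formed in the subring or in the
  whole ring, so both unit groups can be described by congruences modulo the same \<open>I\<close>.\<close>

lemma (in cring) quotient_units_inherited_iff:
  assumes K: "subring K R" and I: "ideal I R" and IK: "I \<subseteq> K"
  shows "quotient_units_inherited K R I \<longleftrightarrow>
    (\<forall>r\<in>K. \<forall>t\<in>carrier R. r \<otimes> t \<ominus> \<one> \<in> I \<longrightarrow> (\<exists>v\<in>K. r \<otimes> v \<ominus> \<one> \<in> I))"
proof -
  let ?S = "R\<lparr>carrier := K\<rparr>"
  have KR: "K \<subseteq> carrier R" by (rule subringE(1)[OF K])
  have S: "cring ?S"
    using K KR subcring_iff subcringI'[OF K] by blast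
  have coset: "I +>\<^bsub>?S\<^esub> a = I +> a" for a
    by (simp add: a_r_coset_def r_coset_def)
  have uS: "I +> r \<in> Units (?S Quot I) \<longleftrightarrow> (\<exists>v\<in>K. r \<otimes> v \<ominus> \<one> \<in> I)" if "r \<in> K" for r
  proof -
    have "I +> r \<in> Units (?S Quot I) \<longleftrightarrow> (\<exists>v\<in>K. I +> (r \<otimes> v) = I +> \<one>)"
      using cring.coset_in_Units_iff[OF S ideal_in_subring[OF K I IK], of r] that
      by (simp add: coset)
    also have "\<dots> \<longleftrightarrow> (\<exists>v\<in>K. r \<otimes> v \<ominus> \<one> \<in> I)"
      using quotient_eq_iff_same_a_r_cos[OF I] that KR by (meson m_closed one_closed subsetD)
    finally show ?thesis .
  qed
  have uT: "I +> r \<in> Units (R Quot I) \<longleftrightarrow> (\<exists>t\<in>carrier R. r \<otimes> t \<ominus> \<one> \<in> I)" if "r \<in> K" for r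
  proof -
    have "I +> r \<in> Units (R Quot I) \<longleftrightarrow> (\<exists>t\<in>carrier R. I +> (r \<otimes> t) = I +> \<one>)"
      using coset_in_Units_iff[OF I, of r] that KR by blast
    also have "\<dots> \<longleftrightarrow> (\<exists>t\<in>carrier R. r \<otimes> t \<ominus> \<one> \<in> I)"
      using quotient_eq_iff_same_a_r_cos[OF I] that KR by (meson m_closed one_closed subsetD)
    finally show ?thesis .
  qed
  have carr: "carrier (?S Quot I) = (\<lambda>a. I +> a) ` K"
    by (simp add: carrier_FactRing coset)
  have sub: "Units (?S Quot I) \<subseteq> (\<lambda>a. I +> a) ` K"
    unfolding carr[symmetric] by (auto simp: Units_def)
  have "quotient_units_inherited K R I \<longleftrightarrow>
      (\<forall>r\<in>K. I +> r \<in> Units (?S Quot I) \<longleftrightarrow> I +> r \<in> Units (R Quot I))"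
    unfolding quotient_units_inherited_def carr using sub by auto
  also have "\<dots> \<longleftrightarrow>
      (\<forall>r\<in>K. (\<exists>v\<in>K. r \<otimes> v \<ominus> \<one> \<in> I) \<longleftrightarrow> (\<exists>t\<in>carrier R. r \<otimes> t \<ominus> \<one> \<in> I))"
    using uS uT by simp
  also have "\<dots> \<longleftrightarrow>
      (\<forall>r\<in>K. \<forall>t\<in>carrier R. r \<otimes> t \<ominus> \<one> \<in> I \<longrightarrow> (\<exists>v\<in>K. r \<otimes> v \<ominus> \<one> \<in> I))"
    using KR by blast
  finally show ?thesis .
qed

section \<open>Integral extensions\<close>

lemma (in cring) power_inverse_mod_ideal:
  assumes I: "ideal I R" and r: "r \<in> carrier R" and t: "t \<in> carrier R"
    and rt: "r \<otimes> t \<ominus> \<one> \<in> I"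
  shows "r [^] (k::nat) \<otimes> t [^] k \<ominus> \<one> \<in> I"
proof (induction k)
  interpret I: ideal I R by (rule I)
  case 0
  then show ?case by (simp add: r_neg minus_eq)
next
  interpret I: ideal I R by (rule I)
  case (Suc k)
  let ?a = "r [^] k" and ?b = "t [^] k"
  have ab: "?a \<in> carrier R" "?b \<in> carrier R" using r t by auto
  have "r [^] Suc k \<otimes> t [^] Suc k \<ominus> \<one> = (?a \<otimes> ?b \<ominus> \<one>) \<otimes> (r \<otimes> t) \<oplus> (r \<otimes> t \<ominus> \<one>)"
    unfolding nat_pow_Suc using ab r t by algebra
  also have "\<dots> \<in> I"
    using Suc rt r t by (intro I.a_closed I.I_r_closed) auto
  finally show ?case .
qed

text \<open>The product equals \<open>r\<^sup>n\<^sup>-\<^sup>k (1 + i)\<close> with \<open>i \<in> I\<close>, and \<open>I\<close> lies in \<open>K\<close>.\<close>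

lemma (in cring) power_absorbs_inverse_power:
  assumes K: "subring K R" and I: "ideal I R" and IK: "I \<subseteq> K"
    and r: "r \<in> K" and t: "t \<in> carrier R" and rt: "r \<otimes> t \<ominus> \<one> \<in> I" and kn: "k \<le> n"
  shows "r [^] (n::nat) \<otimes> t [^] (k::nat) \<in> K"
proof -
  note KE = subringE[OF K]
  interpret S: ring "R\<lparr>carrier := K\<rparr>" by (rule subring_is_ring[OF K])
  have rR: "r \<in> carrier R" using r KE(1) by blast
  have pow: "r [^] (n - k) \<in> K"
    using S.nat_pow_closed[of r "n - k"] r by (simp add: nat_pow_consistent[symmetric])
  let ?i = "r [^] k \<otimes> t [^] k \<ominus> \<one>"
  have i: "?i \<in> K" using power_inverse_mod_ideal[OF I rR t rt] IK by blast
  have "r [^] n = r [^] (n - k) \<otimes> r [^] k"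
    using kn rR by (simp add: nat_pow_mult)
  moreover have "r [^] k \<in> carrier R" "t [^] k \<in> carrier R" "r [^] (n - k) \<in> carrier R"
    using rR t by auto
  ultimately have "r [^] n \<otimes> t [^] k = r [^] (n - k) \<otimes> (\<one> \<oplus> ?i)"
    by (simp only:) algebra
  also have "\<dots> \<in> K" by (intro KE(6) KE(7) pow KE(3) i)
  finally show ?thesis .
qed

lemma (in cring) power_absorbs_eval:
  assumes K: "subring K R" and I: "ideal I R" and IK: "I \<subseteq> K"
    and r: "r \<in> K" and t: "t \<in> carrier R" and rt: "r \<otimes> t \<ominus> \<one> \<in> I"
    and "set p \<subseteq> K" and "length p - 1 \<le> n"
  shows "r [^] (n::nat) \<otimes> eval p t \<in> K"
  using assms(7,8)
proof (induction p)
  note KE = subringE[OF K]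
  case Nil
  then show ?case using r KE(1,2) by auto
next
  note KE = subringE[OF K]
  case (Cons a p)
  have rR: "r \<in> carrier R" using r KE(1) by blast
  have aK: "a \<in> K" using Cons.prems by auto
  have a: "a \<in> carrier R" using aK KE(1) by blast
  have p: "eval p t \<in> carrier R"
    using eval_in_carrier[of p t] t Cons.prems KE(1) by auto
  have 1: "r [^] n \<otimes> t [^] length p \<in> K"
    using power_absorbs_inverse_power[OF K I IK r t rt] Cons.prems by simp
  have 2: "r [^] n \<otimes> eval p t \<in> K"
    using Cons by auto
  have carr: "r [^] n \<in> carrier R" "t [^] length p \<in> carrier R" using rR t by auto
  have "r [^] n \<otimes> eval (a # p) t = r [^] n \<otimes> (a \<otimes> t [^] length p \<oplus> eval p t)"
    by simp
  also have "\<dots> = a \<otimes> (r [^] n \<otimes> t [^] length p) \<oplus> r [^] n \<otimes> eval p t"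
    using carr a p by algebra
  also have "\<dots> \<in> K" by (intro KE(7) KE(6) 1 2 aK)
  finally show ?case .
qed

text \<open>For \<open>n\<close> the degree of \<open>p\<close>, the factor \<open>r\<^sup>n\<^sup>-\<^sup>1\<close> is large enough to bring the terms of degree
  below \<open>n\<close> into \<open>K\<close>, and small enough to leave one factor \<open>t\<close> of the leading term.\<close>

lemma (in cring) integral_inverse_in_subring:
  assumes K: "subring K R" and I: "ideal I R" and IK: "I \<subseteq> K"
    and r: "r \<in> K" and t: "t \<in> carrier R" and rt: "r \<otimes> t \<ominus> \<one> \<in> I"
    and p: "p \<noteq> []" "set p \<subseteq> K" "lead_coeff p = \<one>" "eval p t = \<zero>"
  shows "t \<in> K"
proof -
  note KE = subringE[OF K]
  interpret I: ideal I R by (rule I)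
  have rR: "r \<in> carrier R" using r KE(1) by blast
  from p obtain q where q: "p = \<one> # q" by (cases p) auto
  have qR: "eval q t \<in> carrier R"
    using eval_in_carrier[of q t] t p(2) q KE(1) by auto
  have eq: "t [^] length q \<oplus> eval q t = \<zero>" using p(4) q t by simp
  show ?thesis
  proof (cases "length q")
    case 0
    \<comment> \<open>The constant monic polynomial has a zero only in the trivial ring.\<close>
    then have "\<one> = \<zero>" using eq by simp
    then have "t = \<zero>" using t by (metis l_null l_one)
    then show ?thesis using KE(2) by simp
  next
    case (Suc m)
    let ?a = "r [^] m" and ?b = "t [^] m"
    have ab: "?a \<in> carrier R" "?b \<in> carrier R" using rR t by auto
    have lower: "?a \<otimes> eval q t \<in> K"
      using power_absorbs_eval[OF K I IK r t rt, of q m] p(2) q Suc by auto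
    have i: "?a \<otimes> ?b \<ominus> \<one> \<in> I" by (rule power_inverse_mod_ideal[OF I rR t rt])
    then have it: "(?a \<otimes> ?b \<ominus> \<one>) \<otimes> t \<in> K" using I.I_r_closed t IK by blast
    have "?b \<otimes> t \<oplus> eval q t = \<zero>" using eq Suc by simp
    then have q_eq: "eval q t = \<ominus> (?b \<otimes> t)"
      using qR ab t by (metis add.inv_comm m_closed minus_equality)
    have "t = \<ominus> (?a \<otimes> (\<ominus> (?b \<otimes> t))) \<oplus> \<ominus> ((?a \<otimes> ?b \<ominus> \<one>) \<otimes> t)"
      using ab t by algebra
    then have "t = \<ominus> (?a \<otimes> eval q t) \<oplus> \<ominus> ((?a \<otimes> ?b \<ominus> \<one>) \<otimes> t)"
      by (simp only: q_eq)
    moreover have "\<dots> \<in> K" by (intro KE(7) KE(5) lower it)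
    ultimately show ?thesis by simp
  qed
qed

lemma (in cring) integral_quotient_units_inherited:
  assumes K: "subring K R" and I: "ideal I R" and IK: "I \<subseteq> K" and int: "integral_over R K"
  shows "quotient_units_inherited K R I"
  unfolding quotient_units_inherited_iff[OF K I IK]
proof (intro ballI impI)
  fix r t assume *: "r \<in> K" "t \<in> carrier R" "r \<otimes> t \<ominus> \<one> \<in> I"
  with int have "t \<in> K"
    unfolding integral_over_def using integral_inverse_in_subring[OF K I IK *] by blast
  with *(3) show "\<exists>v\<in>K. r \<otimes> v \<ominus> \<one> \<in> I" by blast
qed

section \<open>Associated subrings and the radical\<close>

text \<open>These are the first two coefficients of \<open>(t + x) u\<close> for a unit \<open>u\<close> of the power series
  ring that moves \<open>t + x\<close> into the series over \<open>K\<close>.\<close>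

lemma (in cring) associated_power_series_coefficients:
  assumes assoc: "associated_subring (carrier (power_series_ring (R\<lparr>carrier := K\<rparr>))) (power_series_ring R)"
    and t: "t \<in> carrier R"
  obtains u\<^sub>0 u\<^sub>1 where "u\<^sub>0 \<in> Units R" "u\<^sub>1 \<in> carrier R"
    "t \<otimes> u\<^sub>0 \<in> K" "t \<otimes> u\<^sub>1 \<oplus> u\<^sub>0 \<in> K"
proof -
  let ?P = "power_series_ring R"
  define f where "f = (\<lambda>n::nat. if n = 0 then t else if n = 1 then \<one> else \<zero>)"
  have "f \<in> carrier ?P" using t by (auto simp: f_def power_series_ring_def)
  then obtain u where u: "u \<in> Units ?P"
    and fu: "f \<otimes>\<^bsub>?P\<^esub> u \<in> carrier (power_series_ring (R\<lparr>carrier := K\<rparr>))"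
    using assoc unfolding associated_subring_def by blast
  have fuK: "(\<Oplus>i\<in>{..n}. f i \<otimes> u (n - i)) \<in> K" for n
    using fu by (auto simp: power_series_ring_def)
  have uR: "u n \<in> carrier R" for n
    using u by (auto simp: Units_def power_series_ring_def)
  obtain w where w: "w \<in> carrier ?P" "w \<otimes>\<^bsub>?P\<^esub> u = \<one>\<^bsub>?P\<^esub>"
    using u by (auto simp: Units_def)
  have wR: "w 0 \<in> carrier R" using w(1) by (auto simp: power_series_ring_def)
  have "w 0 \<otimes> u 0 = \<one>"
    using fun_cong[OF w(2), of 0] wR uR by (simp add: power_series_ring_def)
  then have "u 0 \<in> Units R"
    using wR uR m_comm[OF wR uR[of 0]] unfolding Units_def by auto
  moreover have "t \<otimes> u 0 \<in> K"
    using fuK[of 0] t uR by (simp add: f_def)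
  moreover have "t \<otimes> u 1 \<oplus> u 0 \<in> K"
    using fuK[of 1] t uR by (simp add: f_def atMost_Suc a_comm)
  ultimately show thesis using that uR by blast
qed

lemma (in cring) associated_of_power_series:
  assumes K: "subring K R"
    and assoc: "associated_subring (carrier (power_series_ring (R\<lparr>carrier := K\<rparr>))) (power_series_ring R)"
  shows "associated_subring K R"
  unfolding associated_subring_def
  using K associated_power_series_coefficients[OF assoc] by metis

text \<open>The inverse modulo \<open>I\<close> is \<open>(u\<^sub>0 - a) u\<^sub>0\<^sup>-\<^sup>2\<close>, since
  \<open>(u\<^sub>0 + a) (u\<^sub>0 - a) = u\<^sub>0\<^sup>2 - a\<^sup>2\<close>. It is needed for \<open>a = t u\<^sub>1\<close>.\<close>

lemma (in cring) unit_plus_nilpotent_mod_ideal: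
  assumes I: "ideal I R" and u0: "u\<^sub>0 \<in> Units R" and a: "a \<in> carrier R" and aa: "a \<otimes> a \<in> I"
  shows "\<exists>s\<in>carrier R. (a \<oplus> u\<^sub>0) \<otimes> s \<ominus> \<one> \<in> I"
proof -
  interpret I: ideal I R by (rule I)
  let ?w = "inv u\<^sub>0"
  have carr: "u\<^sub>0 \<in> carrier R" "?w \<in> carrier R" using u0 by auto
  have uw: "u\<^sub>0 \<otimes> ?w = \<one>" using u0 by simp
  have "(a \<oplus> u\<^sub>0) \<otimes> ((u\<^sub>0 \<ominus> a) \<otimes> (?w \<otimes> ?w)) \<ominus> \<one>
      = (u\<^sub>0 \<otimes> ?w) \<otimes> (u\<^sub>0 \<otimes> ?w) \<ominus> \<one> \<ominus> (a \<otimes> a) \<otimes> (?w \<otimes> ?w)"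
    using carr a by algebra
  also have "\<dots> = \<ominus> ((a \<otimes> a) \<otimes> (?w \<otimes> ?w))"
    using carr a by (simp add: uw minus_eq r_neg)
  also have "\<dots> \<in> I"
    using carr by (intro I.a_inv_closed I.I_r_closed[OF aa]) auto
  finally show ?thesis using carr a by blast
qed

text \<open>The identity behind this is \<open>t = (t u\<^sub>0) v + t\<^sup>2 u\<^sub>1 v - t i\<close>, where
  \<open>i = (t u\<^sub>1 + u\<^sub>0) v - 1\<close>: the first term lies in \<open>K\<close>, the others lie in \<open>I\<close>.\<close>

lemma (in cring) square_in_ideal_imp_in_subring:
  assumes K: "subring K R" and I: "ideal I R" and IK: "I \<subseteq> K"
    and inh: "quotient_units_inherited K R I"
    and assoc: "associated_subring (carrier (power_series_ring (R\<lparr>carrier := K\<rparr>))) (power_series_ring R)"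
    and t: "t \<in> carrier R" and tt: "t \<otimes> t \<in> I"
  shows "t \<in> K"
proof -
  interpret I: ideal I R by (rule I)
  note KE = subringE[OF K]
  obtain u\<^sub>0 u\<^sub>1 where u0: "u\<^sub>0 \<in> Units R" and u1: "u\<^sub>1 \<in> carrier R"
    and c0: "t \<otimes> u\<^sub>0 \<in> K" and c1: "t \<otimes> u\<^sub>1 \<oplus> u\<^sub>0 \<in> K"
    using associated_power_series_coefficients[OF assoc t] .
  have u0R: "u\<^sub>0 \<in> carrier R" using u0 by auto
  have "(t \<otimes> u\<^sub>1) \<otimes> (t \<otimes> u\<^sub>1) = (t \<otimes> t) \<otimes> (u\<^sub>1 \<otimes> u\<^sub>1)"
    using t u1 by algebra
  also have "\<dots> \<in> I" using u1 by (intro I.I_r_closed[OF tt]) auto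
  finally obtain s where "s \<in> carrier R" "(t \<otimes> u\<^sub>1 \<oplus> u\<^sub>0) \<otimes> s \<ominus> \<one> \<in> I"
    using unit_plus_nilpotent_mod_ideal[OF I u0, of "t \<otimes> u\<^sub>1"] t u1 by blast
  then obtain v where v: "v \<in> K" and i: "(t \<otimes> u\<^sub>1 \<oplus> u\<^sub>0) \<otimes> v \<ominus> \<one> \<in> I"
    using inh c1 unfolding quotient_units_inherited_iff[OF K I IK] by blast
  have vR: "v \<in> carrier R" using v KE(1) by blast
  let ?i = "(t \<otimes> u\<^sub>1 \<oplus> u\<^sub>0) \<otimes> v \<ominus> \<one>"
  have "t = (t \<otimes> u\<^sub>0) \<otimes> v \<oplus> ((t \<otimes> t) \<otimes> (u\<^sub>1 \<otimes> v) \<oplus> \<ominus> (t \<otimes> ?i))"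
    using t u0R u1 vR by algebra
  moreover have "(t \<otimes> t) \<otimes> (u\<^sub>1 \<otimes> v) \<oplus> \<ominus> (t \<otimes> ?i) \<in> I"
    by (intro I.a_closed I.a_inv_closed I.I_r_closed[OF tt] I.I_l_closed[OF i] m_closed t u1 vR)
  moreover have "(t \<otimes> u\<^sub>0) \<otimes> v \<in> K" by (intro KE(6) c0 v)
  ultimately show ?thesis using IK KE(7) by (metis subsetD)
qed

text \<open>All multiples of \<open>t\<close> have their squares in the conductor too, so they lie in \<open>K\<close> by the
  previous lemma.\<close>

lemma (in cring) square_in_conductor:
  assumes K: "subring K R"
    and inh: "quotient_units_inherited K R (conductor K R)"
    and assoc: "associated_subring (carrier (power_series_ring (R\<lparr>carrier := K\<rparr>))) (power_series_ring R)"
    and t: "t \<in> carrier R" and tt: "t \<otimes> t \<in> conductor K R"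
  shows "t \<in> conductor K R"
proof -
  have I: "ideal (conductor K R) R" by (rule conductor_ideal[OF K])
  interpret I: ideal "conductor K R" R by (rule I)
  have IK: "conductor K R \<subseteq> K" by (auto simp: conductor_def)
  have ts: "t \<otimes> s \<in> K" if s: "s \<in> carrier R" for s
  proof -
    have "(t \<otimes> s) \<otimes> (t \<otimes> s) = (t \<otimes> t) \<otimes> (s \<otimes> s)" using t s by algebra
    also have "\<dots> \<in> conductor K R" using s by (intro I.I_r_closed[OF tt]) auto
    finally show ?thesis
      using square_in_ideal_imp_in_subring[OF K I IK inh assoc] t s by blast
  qed
  have "t \<in> K" using ts[of \<one>] t by simp
  with ts show ?thesis unfolding conductor_def by blast
qed

text \<open>Rounding \<open>n / 2\<close> up lowers an exponent \<open>n > 1\<close> with \<open>t\<^sup>n \<in> I\<close> until it is \<open>1\<close>.\<close>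

lemma (in cring) radical_ideal_if_squares:
  assumes I: "ideal I R" and sq: "\<And>t. t \<in> carrier R \<Longrightarrow> t \<otimes> t \<in> I \<Longrightarrow> t \<in> I"
  shows "radical_ideal I R"
proof -
  interpret I: ideal I R by (rule I)
  have root: "t \<in> I" if "n > 0" "t \<in> carrier R" "t [^] n \<in> I" for t and n :: nat
    using that
  proof (induction n rule: less_induct)
    case (less n)
    show ?case
    proof (cases "n = 1")
      case True
      then show ?thesis using less.prems by simp
    next
      case False
      define m where "m = (n + 1) div 2"
      have m: "0 < m" "m < n" "n \<le> m + m" using False less.prems(1) by (auto simp: m_def)
      have "t [^] m \<otimes> t [^] m = t [^] n \<otimes> t [^] (m + m - n)"
        using m less.prems(2) by (simp add: nat_pow_mult)
      also have "\<dots> \<in> I" using less.prems by (intro I.I_r_closed) auto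
      finally have "t [^] m \<in> I" using sq less.prems(2) by blast
      with less.IH m less.prems(2) show ?thesis by blast
    qed
  qed
  have "radical I R = I"
  proof
    show "radical I R \<subseteq> I" using root by (auto simp: radical_def)
    show "I \<subseteq> radical I R"
      using I.a_subset by (auto simp: radical_def intro!: exI[of _ "1::nat"])
  qed
  with I show ?thesis by (simp add: radical_ideal_def)
qed

theorem theorem5p6:
  fixes T :: "('a, 'b) ring_scheme" and R I :: "'a set"
  assumes "cring T"
    and "subring R T"
    and "R \<noteq> carrier T"
    and "I = conductor R T"
  shows "(integral_over T R \<longrightarrow> quotient_units_inherited R T I) \<and>
    (quotient_units_inherited R T I \<and>
     associated_subring (carrier (power_series_ring (T\<lparr>carrier := R\<rparr>))) (power_series_ring T)
       \<longrightarrow> associated_subring R T \<and> radical_ideal I T)"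
proof -
  interpret T: cring T by fact
  have I: "ideal I T" using T.conductor_ideal[OF assms(2)] assms(4) by simp
  have IR: "I \<subseteq> R" using assms(4) by (auto simp: conductor_def)
  show ?thesis
    using T.integral_quotient_units_inherited[OF assms(2) I IR]
      T.associated_of_power_series[OF assms(2)]
      T.radical_ideal_if_squares[OF I] T.square_in_conductor[OF assms(2)] assms(4)
    by blast
qed

end
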